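(* Let $\mathscr{K}$ be an essentially small monoidal-triangulated category and let $\mathscr{P}$ be a thick $\otimes$-ideal of $\mathscr{K}$. The following are equivalent: (a) $\mathscr{P}$ is prime, i.e. for all thick $\otimes$-ideals $\mathscr{I},\mathscr{J}$, $\mathscr{I}\otimes\mathscr{J}\subseteq\mathscr{P}$ implies $\mathscr{I}\subseteq\mathscr{P}$ or $\mathscr{J}\subseteq\mathscr{P}$; (b) for all $x,y\in\mathscr{K}$, $x\otimes\mathscr{K}\otimes y\subseteq\mathscr{P}$ implies $x\in\mathscr{P}$ or $y\in\mathscr{P}$; (c) $\mathscr{P}$ is prime with respect to semiprimes, i.e. for all semiprime thick $\otimes$-ideals $\mathscr{I},\mathscr{J}$, $\mathscr{I}\otimes\mathscr{J}\subseteq\mathscr{P}$ implies $\mathscr{I}\subseteq\mathscr{P}$ or $\mathscr{J}\subseteq\mathscr{P}$; (d) $\mathscr{P}$ is meet-prime in $T_s(\mathscr{K})$.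
   Context: A monoidal-triangulated category is a triangulated category $\mathscr{K}$ with a monoidal structure $(\otimes,\mathbb{1})$, not assumed symmetric or braided, such that $\otimes$ is exact in each variable. A thick subcategory is a full triangulated subcategory closed under direct summands; a thick $\otimes$-ideal is a thick subcategory $\mathscr{I}$ with $x\otimes y,\ y\otimes x\in\mathscr{I}$ for all $x\in\mathscr{I}$, $y\in\mathscr{K}$. The term prime is used for proper thick $\otimes$-ideals. For collections of objects, $\mathscr{I}\otimes\mathscr{J}=\{a\otimes b\mid a\in\mathscr{I},b\in\mathscr{J}\}$ and $x\otimes\mathscr{K}\otimes y=\{x\otimes z\otimes y\mid z\in\mathscr{K}\}$. A thick $\otimes$-ideal $\mathscr{I}$ is semiprime if it is an intersection of prime thick $\otimes$-ideals ($\mathscr{K}$ being the empty intersection); equivalently, for all $x\in\mathscr{K}$, $x\otimes\mathscr{K}\otimes x\subseteq\mathscr{I}$ implies $x\in\mathscr{I}$. $T_s(\mathscr{K})$ is the complete lattice of semiprime thick $\otimes$-ideals ordered by inclusion, with meet given by intersection. An element $p$ of a lattice is meet-prime if $a\wedge b\le p$ implies $a\le p$ or $b\le p$.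
   Formalization: Condition (c) is taken to include that P is itself semiprime; for an arbitrary thick ideal P the displayed condition in (c) alone does not imply (a), e.g. P = 0 in D^b(k)^3 graded in degrees 0, 1, 2 with truncated tensor product. *)

theory Defs
  imports "HOL-Algebra.Group"
begin

section \<open>Categories, functors and natural isomorphisms\<close>

record ('o, 'm) category =
  Obj :: "'o set"
  Hom :: "'o \<Rightarrow> 'o \<Rightarrow> 'm set"
  Ident :: "'o \<Rightarrow> 'm"
  Comp :: "'m \<Rightarrow> 'm \<Rightarrow> 'm"  (infixr "\<cdot>\<index>" 75)

text \<open>Since the objects form a set over a HOL type, a category in this sense is always small. An
  essentially small category is represented by a small category equivalent to it, so essential
  smallness needs no separate axiom.\<close>

locale category =
  fixes K :: "('o, 'm, 'z) category_scheme" (structure)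
  assumes Ident_in: "x \<in> Obj K \<Longrightarrow> Ident K x \<in> Hom K x x"
    and Comp_in: "\<lbrakk>x \<in> Obj K; y \<in> Obj K; z \<in> Obj K; f \<in> Hom K x y; g \<in> Hom K y z\<rbrakk>
      \<Longrightarrow> g \<cdot> f \<in> Hom K x z"
    and Comp_Ident: "\<lbrakk>x \<in> Obj K; y \<in> Obj K; f \<in> Hom K x y\<rbrakk> \<Longrightarrow> f \<cdot> Ident K x = f"
    and Ident_Comp: "\<lbrakk>x \<in> Obj K; y \<in> Obj K; f \<in> Hom K x y\<rbrakk> \<Longrightarrow> Ident K y \<cdot> f = f"
    and Comp_assoc: "\<lbrakk>w \<in> Obj K; x \<in> Obj K; y \<in> Obj K; z \<in> Obj K;
        f \<in> Hom K w x; g \<in> Hom K x y; h \<in> Hom K y z\<rbrakk> \<Longrightarrow> (h \<cdot> g) \<cdot> f = h \<cdot> (g \<cdot> f)"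
    and Hom_disjoint: "\<lbrakk>x \<in> Obj K; y \<in> Obj K; x' \<in> Obj K; y' \<in> Obj K;
        f \<in> Hom K x y; f \<in> Hom K x' y'\<rbrakk> \<Longrightarrow> x = x' \<and> y = y'"

definition is_iso_mor :: "('o, 'm, 'z) category_scheme \<Rightarrow> 'o \<Rightarrow> 'o \<Rightarrow> 'm \<Rightarrow> bool" where
  "is_iso_mor K x y f \<longleftrightarrow> f \<in> Hom K x y \<and>
    (\<exists>g \<in> Hom K y x. g \<cdot>\<^bsub>K\<^esub> f = Ident K x \<and> f \<cdot>\<^bsub>K\<^esub> g = Ident K y)"

definition isomorphic :: "('o, 'm, 'z) category_scheme \<Rightarrow> 'o \<Rightarrow> 'o \<Rightarrow> bool" where
  "isomorphic K x y \<longleftrightarrow> x \<in> Obj K \<and> y \<in> Obj K \<and> (\<exists>f. is_iso_mor K x y f)"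

definition prod_category ::
  "('o, 'm, 'y) category_scheme \<Rightarrow> ('p, 'n, 'z) category_scheme \<Rightarrow> ('o \<times> 'p, 'm \<times> 'n) category" where
  "prod_category K L = \<lparr>Obj = Obj K \<times> Obj L,
     Hom = (\<lambda>x y. Hom K (fst x) (fst y) \<times> Hom L (snd x) (snd y)),
     Ident = (\<lambda>x. (Ident K (fst x), Ident L (snd x))),
     Comp = (\<lambda>g f. (fst g \<cdot>\<^bsub>K\<^esub> fst f, snd g \<cdot>\<^bsub>L\<^esub> snd f))\<rparr>"

definition is_functor ::
  "('o, 'm, 'y) category_scheme \<Rightarrow> ('p, 'n, 'z) category_scheme \<Rightarrow> ('o \<Rightarrow> 'p) \<Rightarrow> ('m \<Rightarrow> 'n) \<Rightarrow> bool"
where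
  "is_functor K L Fo Fm \<longleftrightarrow>
    (\<forall>x \<in> Obj K. Fo x \<in> Obj L) \<and>
    (\<forall>x \<in> Obj K. \<forall>y \<in> Obj K. \<forall>f \<in> Hom K x y. Fm f \<in> Hom L (Fo x) (Fo y)) \<and>
    (\<forall>x \<in> Obj K. Fm (Ident K x) = Ident L (Fo x)) \<and>
    (\<forall>x \<in> Obj K. \<forall>y \<in> Obj K. \<forall>z \<in> Obj K. \<forall>f \<in> Hom K x y. \<forall>g \<in> Hom K y z.
       Fm (g \<cdot>\<^bsub>K\<^esub> f) = Fm g \<cdot>\<^bsub>L\<^esub> Fm f)"

definition is_equivalence ::
  "('o, 'm, 'y) category_scheme \<Rightarrow> ('p, 'n, 'z) category_scheme \<Rightarrow> ('o \<Rightarrow> 'p) \<Rightarrow> ('m \<Rightarrow> 'n) \<Rightarrow> bool"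
where
  "is_equivalence K L Fo Fm \<longleftrightarrow> is_functor K L Fo Fm \<and>
    (\<forall>x \<in> Obj K. \<forall>y \<in> Obj K. bij_betw Fm (Hom K x y) (Hom L (Fo x) (Fo y))) \<and>
    (\<forall>y \<in> Obj L. \<exists>x \<in> Obj K. isomorphic L (Fo x) y)"

definition natural_iso ::
  "('o, 'm, 'y) category_scheme \<Rightarrow> ('p, 'n, 'z) category_scheme \<Rightarrow> ('o \<Rightarrow> 'p) \<Rightarrow> ('m \<Rightarrow> 'n)
    \<Rightarrow> ('o \<Rightarrow> 'p) \<Rightarrow> ('m \<Rightarrow> 'n) \<Rightarrow> ('o \<Rightarrow> 'n) \<Rightarrow> bool"
where
  "natural_iso K L Fo Fm Go Gm \<eta> \<longleftrightarrow>
    (\<forall>x \<in> Obj K. is_iso_mor L (Fo x) (Go x) (\<eta> x)) \<and>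
    (\<forall>x \<in> Obj K. \<forall>y \<in> Obj K. \<forall>f \<in> Hom K x y. \<eta> y \<cdot>\<^bsub>L\<^esub> Fm f = Gm f \<cdot>\<^bsub>L\<^esub> \<eta> x)"


section \<open>Additive categories\<close>

record ('o, 'm) preadditive_category = "('o, 'm) category" +
  Add :: "'m \<Rightarrow> 'm \<Rightarrow> 'm"  (infixl "\<oplus>\<^sub>m\<index>" 65)
  Zero :: "'o \<Rightarrow> 'o \<Rightarrow> 'm"

definition hom_group :: "('o, 'm, 'z) preadditive_category_scheme \<Rightarrow> 'o \<Rightarrow> 'o \<Rightarrow> 'm monoid" where
  "hom_group K x y = \<lparr>carrier = Hom K x y, mult = Add K, one = Zero K x y\<rparr>"

locale preadditive_category = category K
  for K :: "('o, 'm, 'z) preadditive_category_scheme" (structure) +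
  assumes hom_comm_group: "\<lbrakk>x \<in> Obj K; y \<in> Obj K\<rbrakk> \<Longrightarrow> comm_group (hom_group K x y)"
    and Comp_Add_right: "\<lbrakk>x \<in> Obj K; y \<in> Obj K; z \<in> Obj K;
        f \<in> Hom K x y; f' \<in> Hom K x y; g \<in> Hom K y z\<rbrakk>
        \<Longrightarrow> g \<cdot> (f \<oplus>\<^sub>m f') = (g \<cdot> f) \<oplus>\<^sub>m (g \<cdot> f')"
    and Comp_Add_left: "\<lbrakk>x \<in> Obj K; y \<in> Obj K; z \<in> Obj K;
        f \<in> Hom K x y; g \<in> Hom K y z; g' \<in> Hom K y z\<rbrakk>
        \<Longrightarrow> (g \<oplus>\<^sub>m g') \<cdot> f = (g \<cdot> f) \<oplus>\<^sub>m (g' \<cdot> f)"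

definition zero_object :: "('o, 'm, 'z) category_scheme \<Rightarrow> 'o \<Rightarrow> bool" where
  "zero_object K z \<longleftrightarrow> z \<in> Obj K \<and>
    (\<forall>x \<in> Obj K. (\<exists>!f. f \<in> Hom K x z) \<and> (\<exists>!f. f \<in> Hom K z x))"

definition is_biproduct :: "('o, 'm, 'z) preadditive_category_scheme \<Rightarrow> 'o \<Rightarrow> 'o \<Rightarrow> 'o \<Rightarrow> bool" where
  "is_biproduct K x y s \<longleftrightarrow> x \<in> Obj K \<and> y \<in> Obj K \<and> s \<in> Obj K \<and>
    (\<exists>i \<in> Hom K x s. \<exists>j \<in> Hom K y s. \<exists>p \<in> Hom K s x. \<exists>q \<in> Hom K s y.
       p \<cdot>\<^bsub>K\<^esub> i = Ident K x \<and> q \<cdot>\<^bsub>K\<^esub> j = Ident K y \<and>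
       p \<cdot>\<^bsub>K\<^esub> j = Zero K y x \<and> q \<cdot>\<^bsub>K\<^esub> i = Zero K x y \<and>
       (i \<cdot>\<^bsub>K\<^esub> p) \<oplus>\<^sub>m\<^bsub>K\<^esub> (j \<cdot>\<^bsub>K\<^esub> q) = Ident K s)"

definition direct_summand :: "('o, 'm, 'z) preadditive_category_scheme \<Rightarrow> 'o \<Rightarrow> 'o \<Rightarrow> bool" where
  "direct_summand K x s \<longleftrightarrow> (\<exists>y \<in> Obj K. is_biproduct K x y s)"

locale additive_category = preadditive_category K
  for K :: "('o, 'm, 'z) preadditive_category_scheme" (structure) +
  assumes zero_object_exists: "\<exists>z. zero_object K z"
    and biproduct_exists: "\<lbrakk>x \<in> Obj K; y \<in> Obj K\<rbrakk> \<Longrightarrow> \<exists>s. is_biproduct K x y s"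

definition is_additive_functor ::
  "('o, 'm, 'y) preadditive_category_scheme \<Rightarrow> ('p, 'n, 'z) preadditive_category_scheme
    \<Rightarrow> ('o \<Rightarrow> 'p) \<Rightarrow> ('m \<Rightarrow> 'n) \<Rightarrow> bool"
where
  "is_additive_functor K L Fo Fm \<longleftrightarrow> is_functor K L Fo Fm \<and>
    (\<forall>x \<in> Obj K. \<forall>y \<in> Obj K. \<forall>f \<in> Hom K x y. \<forall>g \<in> Hom K x y.
       Fm (f \<oplus>\<^sub>m\<^bsub>K\<^esub> g) = Fm f \<oplus>\<^sub>m\<^bsub>L\<^esub> Fm g)"


section \<open>Triangulated categories\<close>

text \<open>A triangle \<open>x \<rightarrow> y \<rightarrow> z \<rightarrow> \<Sigma> x\<close> is recorded by its three morphisms, which determine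
  the objects since hom-sets are disjoint.\<close>

record ('o, 'm) triangulated_category = "('o, 'm) preadditive_category" +
  Shift :: "'o \<Rightarrow> 'o"
  Shift_mor :: "'m \<Rightarrow> 'm"
  Dist :: "('m \<times> 'm \<times> 'm) set"

definition triangle ::
  "('o, 'm, 'z) triangulated_category_scheme \<Rightarrow> 'o \<Rightarrow> 'o \<Rightarrow> 'o \<Rightarrow> 'm \<Rightarrow> 'm \<Rightarrow> 'm \<Rightarrow> bool" where
  "triangle K x y z f g h \<longleftrightarrow> x \<in> Obj K \<and> y \<in> Obj K \<and> z \<in> Obj K \<and>
    f \<in> Hom K x y \<and> g \<in> Hom K y z \<and> h \<in> Hom K z (Shift K x)"

definition dist_triangle ::
  "('o, 'm, 'z) triangulated_category_scheme \<Rightarrow> 'o \<Rightarrow> 'o \<Rightarrow> 'o \<Rightarrow> 'm \<Rightarrow> 'm \<Rightarrow> 'm \<Rightarrow> bool" where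
  "dist_triangle K x y z f g h \<longleftrightarrow> triangle K x y z f g h \<and> (f, g, h) \<in> Dist K"

text \<open>The axioms TR1--TR4; the shift is only required to be an auto-equivalence, which includes
  the convention that it is an automorphism.\<close>

locale triangulated_category = additive_category K
  for K :: "('o, 'm, 'z) triangulated_category_scheme" (structure) +
  assumes Shift_additive: "is_additive_functor K K (Shift K) (Shift_mor K)"
    and Shift_equivalence: "is_equivalence K K (Shift K) (Shift_mor K)"
    and Dist_triangle: "(f, g, h) \<in> Dist K \<Longrightarrow> \<exists>x y z. triangle K x y z f g h"
    and TR1_iso: "\<lbrakk>dist_triangle K x y z f g h; triangle K x' y' z' f' g' h';
        is_iso_mor K x x' u; is_iso_mor K y y' v; is_iso_mor K z z' w;
        v \<cdot> f = f' \<cdot> u; w \<cdot> g = g' \<cdot> v; Shift_mor K u \<cdot> h = h' \<cdot> w\<rbrakk>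
        \<Longrightarrow> dist_triangle K x' y' z' f' g' h'"
    and TR1_ident: "\<lbrakk>x \<in> Obj K; zero_object K z\<rbrakk>
        \<Longrightarrow> dist_triangle K x x z (Ident K x) (Zero K x z) (Zero K z (Shift K x))"
    and TR1_cone: "\<lbrakk>x \<in> Obj K; y \<in> Obj K; f \<in> Hom K x y\<rbrakk>
        \<Longrightarrow> \<exists>z g h. dist_triangle K x y z f g h"
    and TR2: "triangle K x y z f g h \<Longrightarrow>
        dist_triangle K x y z f g h \<longleftrightarrow>
        dist_triangle K y z (Shift K x) g h
          (inv\<^bsub>hom_group K (Shift K x) (Shift K y)\<^esub> (Shift_mor K f))"
    and TR3: "\<lbrakk>dist_triangle K x y z f g h; dist_triangle K x' y' z' f' g' h';
        u \<in> Hom K x x'; v \<in> Hom K y y'; v \<cdot> f = f' \<cdot> u\<rbrakk>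
        \<Longrightarrow> \<exists>w \<in> Hom K z z'. w \<cdot> g = g' \<cdot> v \<and> Shift_mor K u \<cdot> h = h' \<cdot> w"
    and TR4: "\<lbrakk>dist_triangle K x y c f f1 f2; dist_triangle K y z d g g1 g2;
        dist_triangle K x z e (g \<cdot> f) h1 h2\<rbrakk>
        \<Longrightarrow> \<exists>a \<in> Hom K c e. \<exists>b \<in> Hom K e d.
          dist_triangle K c e d a b (Shift_mor K f1 \<cdot> g2) \<and>
          a \<cdot> f1 = h1 \<cdot> g \<and> h2 \<cdot> a = f2 \<and> b \<cdot> h1 = g1 \<and> g2 \<cdot> b = Shift_mor K f \<cdot> h2"

definition is_exact_functor ::
  "('o, 'm, 'y) triangulated_category_scheme \<Rightarrow> ('p, 'n, 'z) triangulated_category_scheme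
    \<Rightarrow> ('o \<Rightarrow> 'p) \<Rightarrow> ('m \<Rightarrow> 'n) \<Rightarrow> bool"
where
  "is_exact_functor K L Fo Fm \<longleftrightarrow> is_additive_functor K L Fo Fm \<and>
    (\<exists>\<xi>. natural_iso K L (Fo \<circ> Shift K) (Fm \<circ> Shift_mor K) (Shift L \<circ> Fo) (Shift_mor L \<circ> Fm) \<xi> \<and>
      (\<forall>x y z f g h. dist_triangle K x y z f g h \<longrightarrow>
         dist_triangle L (Fo x) (Fo y) (Fo z) (Fm f) (Fm g) (\<xi> x \<cdot>\<^bsub>L\<^esub> Fm h)))"


section \<open>Monoidal-triangulated categories\<close>

record ('o, 'm) mt_category = "('o, 'm) triangulated_category" +
  Tensor :: "'o \<Rightarrow> 'o \<Rightarrow> 'o"  (infixl "\<otimes>\<^sub>o\<index>" 70)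
  Tensor_mor :: "'m \<Rightarrow> 'm \<Rightarrow> 'm"  (infixl "\<otimes>\<^sub>m\<index>" 80)
  Unit :: 'o
  Associator :: "'o \<Rightarrow> 'o \<Rightarrow> 'o \<Rightarrow> 'm"
  Left_unitor :: "'o \<Rightarrow> 'm"
  Right_unitor :: "'o \<Rightarrow> 'm"

locale monoidal_triangulated_category = triangulated_category K
  for K :: "('o, 'm, 'z) mt_category_scheme" (structure) +
  assumes Tensor_functor: "is_functor (prod_category K K) K
        (\<lambda>(x, y). x \<otimes>\<^sub>o y) (\<lambda>(f, g). f \<otimes>\<^sub>m g)"
    and Unit_in: "Unit K \<in> Obj K"
    and Associator_natural: "natural_iso (prod_category K (prod_category K K)) K
        (\<lambda>(x, y, z). (x \<otimes>\<^sub>o y) \<otimes>\<^sub>o z) (\<lambda>(f, g, h). (f \<otimes>\<^sub>m g) \<otimes>\<^sub>m h)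
        (\<lambda>(x, y, z). x \<otimes>\<^sub>o (y \<otimes>\<^sub>o z)) (\<lambda>(f, g, h). f \<otimes>\<^sub>m (g \<otimes>\<^sub>m h))
        (\<lambda>(x, y, z). Associator K x y z)"
    and Left_unitor_natural: "natural_iso K K
        (\<lambda>x. Unit K \<otimes>\<^sub>o x) (\<lambda>f. Ident K (Unit K) \<otimes>\<^sub>m f) (\<lambda>x. x) (\<lambda>f. f) (Left_unitor K)"
    and Right_unitor_natural: "natural_iso K K
        (\<lambda>x. x \<otimes>\<^sub>o Unit K) (\<lambda>f. f \<otimes>\<^sub>m Ident K (Unit K)) (\<lambda>x. x) (\<lambda>f. f) (Right_unitor K)"
    and pentagon: "\<lbrakk>w \<in> Obj K; x \<in> Obj K; y \<in> Obj K; z \<in> Obj K\<rbrakk> \<Longrightarrow>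
        Associator K w x (y \<otimes>\<^sub>o z) \<cdot> Associator K (w \<otimes>\<^sub>o x) y z =
        (Ident K w \<otimes>\<^sub>m Associator K x y z) \<cdot> Associator K w (x \<otimes>\<^sub>o y) z \<cdot>
          (Associator K w x y \<otimes>\<^sub>m Ident K z)"
    and unit_triangle: "\<lbrakk>x \<in> Obj K; y \<in> Obj K\<rbrakk> \<Longrightarrow>
        (Ident K x \<otimes>\<^sub>m Left_unitor K y) \<cdot> Associator K x (Unit K) y =
        Right_unitor K x \<otimes>\<^sub>m Ident K y"
    and Tensor_exact_right: "x \<in> Obj K \<Longrightarrow>
        is_exact_functor K K (\<lambda>y. x \<otimes>\<^sub>o y) (\<lambda>f. Ident K x \<otimes>\<^sub>m f)"
    and Tensor_exact_left: "y \<in> Obj K \<Longrightarrow>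
        is_exact_functor K K (\<lambda>x. x \<otimes>\<^sub>o y) (\<lambda>f. f \<otimes>\<^sub>m Ident K y)"


section \<open>Thick tensor ideals and their primeness\<close>

text \<open>Full subcategories are given by their sets of objects, and triangulated subcategories are
  closed under isomorphism. The shift condition is an equivalence in order to cover closure under
  both directions of the shift.\<close>

definition triangulated_subcategory :: "('o, 'm, 'z) triangulated_category_scheme \<Rightarrow> 'o set \<Rightarrow> bool"
where
  "triangulated_subcategory K S \<longleftrightarrow> S \<subseteq> Obj K \<and>
    (\<forall>z. zero_object K z \<longrightarrow> z \<in> S) \<and>
    (\<forall>x y. isomorphic K x y \<longrightarrow> x \<in> S \<longrightarrow> y \<in> S) \<and>
    (\<forall>x \<in> Obj K. x \<in> S \<longleftrightarrow> Shift K x \<in> S) \<and>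
    (\<forall>x y z f g h. dist_triangle K x y z f g h \<longrightarrow> x \<in> S \<longrightarrow> y \<in> S \<longrightarrow> z \<in> S)"

definition thick_subcategory :: "('o, 'm, 'z) triangulated_category_scheme \<Rightarrow> 'o set \<Rightarrow> bool" where
  "thick_subcategory K S \<longleftrightarrow> triangulated_subcategory K S \<and>
    (\<forall>x s. direct_summand K x s \<longrightarrow> s \<in> S \<longrightarrow> x \<in> S)"

definition thick_ideals :: "('o, 'm, 'z) mt_category_scheme \<Rightarrow> 'o set set" where
  "thick_ideals K = {I. thick_subcategory K I \<and>
    (\<forall>x \<in> I. \<forall>y \<in> Obj K. x \<otimes>\<^sub>o\<^bsub>K\<^esub> y \<in> I \<and> y \<otimes>\<^sub>o\<^bsub>K\<^esub> x \<in> I)}"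

definition tensor_set :: "('o, 'm, 'z) mt_category_scheme \<Rightarrow> 'o set \<Rightarrow> 'o set \<Rightarrow> 'o set" where
  "tensor_set K I J = {a \<otimes>\<^sub>o\<^bsub>K\<^esub> b | a b. a \<in> I \<and> b \<in> J}"

definition sandwich :: "('o, 'm, 'z) mt_category_scheme \<Rightarrow> 'o \<Rightarrow> 'o \<Rightarrow> 'o set" where
  "sandwich K x y = {x \<otimes>\<^sub>o\<^bsub>K\<^esub> z \<otimes>\<^sub>o\<^bsub>K\<^esub> y | z. z \<in> Obj K}"

definition prime_wrt :: "('o, 'm, 'z) mt_category_scheme \<Rightarrow> 'o set set \<Rightarrow> 'o set \<Rightarrow> bool" where
  "prime_wrt K F P \<longleftrightarrow>
    (\<forall>I \<in> F. \<forall>J \<in> F. tensor_set K I J \<subseteq> P \<longrightarrow> I \<subseteq> P \<or> J \<subseteq> P)"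

definition prime_ideals :: "('o, 'm, 'z) mt_category_scheme \<Rightarrow> 'o set set" where
  "prime_ideals K = {P \<in> thick_ideals K. P \<noteq> Obj K \<and> prime_wrt K (thick_ideals K) P}"

definition prime_on_objects :: "('o, 'm, 'z) mt_category_scheme \<Rightarrow> 'o set \<Rightarrow> bool" where
  "prime_on_objects K P \<longleftrightarrow>
    (\<forall>x \<in> Obj K. \<forall>y \<in> Obj K. sandwich K x y \<subseteq> P \<longrightarrow> x \<in> P \<or> y \<in> P)"

text \<open>Intersecting with \<open>Obj K\<close> makes the empty intersection equal to the whole category.\<close>

definition semiprime_ideals :: "('o, 'm, 'z) mt_category_scheme \<Rightarrow> 'o set set" where
  "semiprime_ideals K = {Obj K \<inter> \<Inter>F | F. F \<subseteq> prime_ideals K}"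

text \<open>\<open>T\<^sub>s(K)\<close>; its meet is intersection, see \<open>meet_semiprime_lattice\<close> below.\<close>

definition semiprime_lattice :: "('o, 'm, 'z) mt_category_scheme \<Rightarrow> 'o set gorder" where
  "semiprime_lattice K = \<lparr>carrier = semiprime_ideals K, eq = (=), le = (\<subseteq>)\<rparr>"

definition meet_prime :: "('a, 'b) gorder_scheme \<Rightarrow> 'a \<Rightarrow> bool" where
  "meet_prime L p \<longleftrightarrow> p \<in> carrier L \<and>
    (\<forall>a \<in> carrier L. \<forall>b \<in> carrier L. a \<sqinter>\<^bsub>L\<^esub> b \<sqsubseteq>\<^bsub>L\<^esub> p \<longrightarrow> a \<sqsubseteq>\<^bsub>L\<^esub> p \<or> b \<sqsubseteq>\<^bsub>L\<^esub> p)"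

text \<open>Being prime with respect to semiprimes is understood as a property of semiprime ideals.
  For an arbitrary thick ideal the condition \<open>prime_wrt K (semiprime_ideals K) P\<close> alone does not
  imply primeness: let \<open>K\<close> be \<open>D\<^sup>b(k)\<^sup>3\<close>, graded in degrees 0, 1, 2, with the graded tensor product
  truncated above degree 2, and let \<open>M\<close> be the ideal of objects concentrated in degrees 1 and 2.
  The only semiprime ideals are \<open>M\<close> and \<open>K\<close>, and no tensor product of two of them is zero, so the
  zero ideal satisfies this condition vacuously; but it is neither prime nor semiprime.\<close>

definition prime_wrt_semiprimes :: "('o, 'm, 'z) mt_category_scheme \<Rightarrow> 'o set \<Rightarrow> bool" where
  "prime_wrt_semiprimes K P \<longleftrightarrow> P \<in> semiprime_ideals K \<and> prime_wrt K (semiprime_ideals K) P"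

lemma semiprime_ideals_Inter:
  assumes "A \<subseteq> semiprime_ideals K"
  shows "Obj K \<inter> \<Inter>A \<in> semiprime_ideals K"
proof -
  have "\<forall>I \<in> A. \<exists>F. F \<subseteq> prime_ideals K \<and> I = Obj K \<inter> \<Inter>F"
    using assms unfolding semiprime_ideals_def by blast
  then obtain \<F> where \<F>: "\<And>I. I \<in> A \<Longrightarrow> \<F> I \<subseteq> prime_ideals K \<and> I = Obj K \<inter> \<Inter>(\<F> I)"
    by metis
  have "Obj K \<inter> \<Inter>A = Obj K \<inter> \<Inter>(\<Union>I\<in>A. \<F> I)"
  proof (rule Set.set_eqI)
    fix x
    have "x \<in> I \<longleftrightarrow> x \<in> Obj K \<and> (\<forall>Q \<in> \<F> I. x \<in> Q)" if "I \<in> A" for I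
      using \<F>[OF that] by auto
    then show "x \<in> Obj K \<inter> \<Inter>A \<longleftrightarrow> x \<in> Obj K \<inter> \<Inter>(\<Union>I\<in>A. \<F> I)"
      by auto
  qed
  moreover have "(\<Union>I\<in>A. \<F> I) \<subseteq> prime_ideals K"
    using \<F> by blast
  ultimately show ?thesis
    unfolding semiprime_ideals_def by blast
qed

lemma partial_order_semiprime_lattice: "partial_order (semiprime_lattice K)"
  by unfold_locales (auto simp: semiprime_lattice_def)

lemma greatest_Lower_semiprime_lattice:
  assumes "A \<subseteq> semiprime_ideals K"
  shows "greatest (semiprime_lattice K) (Obj K \<inter> \<Inter>A) (Lower (semiprime_lattice K) A)"
proof -
  have "I \<subseteq> Obj K" if "I \<in> semiprime_ideals K" for I
    using that unfolding semiprime_ideals_def by blast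
  then show ?thesis
    using semiprime_ideals_Inter[OF assms] assms
    unfolding greatest_def Lower_def semiprime_lattice_def by (auto 0 4)
qed

lemma complete_lattice_semiprime_lattice: "complete_lattice (semiprime_lattice K)"
proof (rule partial_order.complete_lattice_criterion1[OF partial_order_semiprime_lattice])
  show "\<exists>g. greatest (semiprime_lattice K) g (carrier (semiprime_lattice K))"
    using greatest_Lower_semiprime_lattice[of "{}" K] by (auto simp: Lower_def)
  show "\<exists>i. greatest (semiprime_lattice K) i (Lower (semiprime_lattice K) A)"
    if "A \<subseteq> carrier (semiprime_lattice K)" for A
    using that greatest_Lower_semiprime_lattice[of A K] by (auto simp: semiprime_lattice_def)
qed

lemma meet_semiprime_lattice:
  assumes "I \<in> semiprime_ideals K" "J \<in> semiprime_ideals K"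
  shows "I \<sqinter>\<^bsub>semiprime_lattice K\<^esub> J = I \<inter> J"
proof -
  let ?L = "semiprime_lattice K"
  have "I \<subseteq> Obj K"
    using assms(1) unfolding semiprime_ideals_def by blast
  then have "Obj K \<inter> \<Inter>{I, J} = I \<inter> J"
    by auto
  with greatest_Lower_semiprime_lattice[of "{I, J}" K] assms
  have "greatest ?L (I \<inter> J) (Lower ?L {I, J})"
    by simp
  moreover have "X = I \<inter> J" if "greatest ?L X (Lower ?L {I, J})" for X
    using that calculation unfolding greatest_def by (auto simp: semiprime_lattice_def)
  ultimately show ?thesis
    unfolding meet_def inf_def by (rule some_equality)
qed

end

theory Submission
  imports Defs
begin

text \<open>If \<open>x \<otimes> K \<otimes> y \<subseteq> P\<close>, then \<open>J = {b. x \<otimes> K \<otimes> b \<subseteq> P}\<close> and \<open>I = {a. a \<otimes> J \<subseteq> P}\<close> are thick ideals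
  containing \<open>y\<close> and \<open>x\<close>, because preimages of thick subcategories under exact functors are thick;
  as \<open>I \<otimes> J \<subseteq> P\<close>, primeness on ideals gives primeness on objects. Conversely, let \<open>P\<close> be the
  intersection of a family of primes and meet-prime among semiprimes. If \<open>I \<otimes> J \<subseteq> P\<close>, each prime of
  the family contains \<open>I\<close> or \<open>J\<close>, so \<open>P\<close> is the meet of the semiprime ideals obtained by intersecting
  those that contain \<open>I\<close> and those that contain \<open>J\<close>, and one of these lies in \<open>P\<close>.\<close>

section \<open>Additive functors\<close>

context category
begin

lemma isomorphic_sym: "isomorphic K x y \<Longrightarrow> isomorphic K y x"
  unfolding isomorphic_def is_iso_mor_def by blast

lemma isomorphic_functor:
  assumes "is_functor K L Fo Fm" "isomorphic K x y"
  shows "isomorphic L (Fo x) (Fo y)"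
proof -
  obtain f g where "x \<in> Obj K" "y \<in> Obj K" "f \<in> Hom K x y" "g \<in> Hom K y x"
    "g \<cdot> f = Ident K x" "f \<cdot> g = Ident K y"
    using assms(2) unfolding isomorphic_def is_iso_mor_def by blast
  with assms(1) show ?thesis
    unfolding is_functor_def isomorphic_def is_iso_mor_def by metis
qed

end

context preadditive_category
begin

lemma Zero_in: "\<lbrakk>x \<in> Obj K; y \<in> Obj K\<rbrakk> \<Longrightarrow> Zero K x y \<in> Hom K x y"
  using comm_group.axioms(2)[OF hom_comm_group, THEN group.is_monoid, THEN monoid.one_closed]
  by (simp add: hom_group_def)

lemma Add_Zero:
  "\<lbrakk>x \<in> Obj K; y \<in> Obj K; f \<in> Hom K x y\<rbrakk> \<Longrightarrow> f \<oplus>\<^sub>m Zero K x y = f"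
  using comm_group.axioms(2)[OF hom_comm_group, THEN group.is_monoid, THEN monoid.r_one]
  by (simp add: hom_group_def)

text \<open>Cancellation in the hom-group. This recognises zero morphisms: an additive map sends a
  zero to a morphism that equals its own double.\<close>

lemma Add_idem_imp_Zero:
  assumes "x \<in> Obj K" "y \<in> Obj K" "f \<in> Hom K x y" "f \<oplus>\<^sub>m f = f"
  shows "f = Zero K x y"
proof -
  interpret comm_group "hom_group K x y"
    using hom_comm_group assms(1,2) .
  show ?thesis
    using r_cancel_one[of f f] assms(3,4) by (simp add: hom_group_def)
qed

lemma Comp_Zero:
  assumes "x \<in> Obj K" "y \<in> Obj K" "z \<in> Obj K" "g \<in> Hom K y z"
  shows "g \<cdot> Zero K x y = Zero K x z"
proof (rule Add_idem_imp_Zero)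
  note Zero = Zero_in[OF assms(1,2)]
  show "g \<cdot> Zero K x y \<in> Hom K x z"
    using assms Zero Comp_in by blast
  show "g \<cdot> Zero K x y \<oplus>\<^sub>m g \<cdot> Zero K x y = g \<cdot> Zero K x y"
    using Comp_Add_right[OF assms(1-3) Zero Zero assms(4)] Add_Zero[OF assms(1,2) Zero] by simp
qed (use assms in simp_all)

lemma Zero_Comp:
  assumes "x \<in> Obj K" "y \<in> Obj K" "z \<in> Obj K" "f \<in> Hom K x y"
  shows "Zero K y z \<cdot> f = Zero K x z"
proof (rule Add_idem_imp_Zero)
  note Zero = Zero_in[OF assms(2,3)]
  show "Zero K y z \<cdot> f \<in> Hom K x z"
    using assms Zero Comp_in by blast
  show "Zero K y z \<cdot> f \<oplus>\<^sub>m Zero K y z \<cdot> f = Zero K y z \<cdot> f"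
    using Comp_Add_left[OF assms(1-3,4) Zero Zero] Add_Zero[OF assms(2,3) Zero] by simp
qed (use assms in simp_all)

text \<open>Any morphism into or out of \<open>z\<close> factors through \<open>Ident K z\<close>,
  so it vanishes once the identity does. Unlike the universal property, this equation is visibly
  preserved by additive functors.\<close>

lemma zero_object_iff: "zero_object K z \<longleftrightarrow> z \<in> Obj K \<and> Ident K z = Zero K z z"
proof
  assume "zero_object K z"
  then show "z \<in> Obj K \<and> Ident K z = Zero K z z"
    unfolding zero_object_def using Ident_in Zero_in by blast
next
  assume z: "z \<in> Obj K \<and> Ident K z = Zero K z z"
  have "f = Zero K x z" if "x \<in> Obj K" "f \<in> Hom K x z" for x f
    using Ident_Comp[of x z f] Zero_Comp[of x z z f] z that by simp
  moreover have "f = Zero K z x" if "x \<in> Obj K" "f \<in> Hom K z x" for x f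
    using Comp_Ident[of z x f] Comp_Zero[of z z x f] z that by simp
  ultimately show "zero_object K z"
    unfolding zero_object_def using z Zero_in by blast
qed

lemma additive_functor_Zero:
  assumes "preadditive_category L" "is_additive_functor K L Fo Fm" "x \<in> Obj K" "y \<in> Obj K"
  shows "Fm (Zero K x y) = Zero L (Fo x) (Fo y)"
proof (rule preadditive_category.Add_idem_imp_Zero[OF assms(1)])
  have F: "is_functor K L Fo Fm"
    using assms(2) unfolding is_additive_functor_def by blast
  show "Fo x \<in> Obj L" "Fo y \<in> Obj L" "Fm (Zero K x y) \<in> Hom L (Fo x) (Fo y)"
    using F assms(3,4) Zero_in unfolding is_functor_def by blast+
  show "Fm (Zero K x y) \<oplus>\<^sub>m\<^bsub>L\<^esub> Fm (Zero K x y) = Fm (Zero K x y)"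
    using assms(2-4) Zero_in Add_Zero unfolding is_additive_functor_def by metis
qed

lemma additive_functor_zero_object:
  assumes "preadditive_category L" "is_additive_functor K L Fo Fm" "zero_object K z"
  shows "zero_object L (Fo z)"
proof -
  have z: "z \<in> Obj K" "Ident K z = Zero K z z"
    using assms(3) zero_object_iff by blast+
  have "is_functor K L Fo Fm"
    using assms(2) unfolding is_additive_functor_def by blast
  then have "Fo z \<in> Obj L" "Fm (Ident K z) = Ident L (Fo z)"
    using z(1) unfolding is_functor_def by blast+
  then show ?thesis
    using preadditive_category.zero_object_iff[OF assms(1)]
      additive_functor_Zero[OF assms(1,2) z(1) z(1)] z(2) by simp
qed

text \<open>A biproduct is encoded by equations between \<open>i\<close>, \<open>j\<close>,
  \<open>p\<close>, \<open>q\<close>, all of which survive an additive functor. Hence direct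
  summands are preserved.\<close>

lemma additive_functor_biproduct:
  assumes "preadditive_category L" "is_additive_functor K L Fo Fm" "is_biproduct K x y s"
  shows "is_biproduct L (Fo x) (Fo y) (Fo s)"
proof -
  have obj: "x \<in> Obj K" "y \<in> Obj K" "s \<in> Obj K"
    using assms(3) unfolding is_biproduct_def by blast+
  obtain i j p q where hom: "i \<in> Hom K x s" "j \<in> Hom K y s" "p \<in> Hom K s x" "q \<in> Hom K s y"
    and eq: "p \<cdot> i = Ident K x" "q \<cdot> j = Ident K y" "p \<cdot> j = Zero K y x" "q \<cdot> i = Zero K x y"
      "(i \<cdot> p) \<oplus>\<^sub>m (j \<cdot> q) = Ident K s"
    using assms(3) unfolding is_biproduct_def by blast
  have F: "is_functor K L Fo Fm" and
    add: "\<And>x y f g. \<lbrakk>x \<in> Obj K; y \<in> Obj K; f \<in> Hom K x y; g \<in> Hom K x y\<rbrakk>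
      \<Longrightarrow> Fm (f \<oplus>\<^sub>m g) = Fm f \<oplus>\<^sub>m\<^bsub>L\<^esub> Fm g"
    using assms(2) unfolding is_additive_functor_def by blast+
  have comp: "\<And>x y z f g. \<lbrakk>x \<in> Obj K; y \<in> Obj K; z \<in> Obj K; f \<in> Hom K x y; g \<in> Hom K y z\<rbrakk>
      \<Longrightarrow> Fm g \<cdot>\<^bsub>L\<^esub> Fm f = Fm (g \<cdot> f)"
    and ident: "\<And>x. x \<in> Obj K \<Longrightarrow> Fm (Ident K x) = Ident L (Fo x)"
    and in_Obj: "\<And>x. x \<in> Obj K \<Longrightarrow> Fo x \<in> Obj L"
    and in_Hom: "\<And>x y f. \<lbrakk>x \<in> Obj K; y \<in> Obj K; f \<in> Hom K x y\<rbrakk> \<Longrightarrow> Fm f \<in> Hom L (Fo x) (Fo y)"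
    using F unfolding is_functor_def by simp_all
  note zero = additive_functor_Zero[OF assms(1,2)]
  have "Fm p \<cdot>\<^bsub>L\<^esub> Fm i = Ident L (Fo x)" "Fm q \<cdot>\<^bsub>L\<^esub> Fm j = Ident L (Fo y)"
    "Fm p \<cdot>\<^bsub>L\<^esub> Fm j = Zero L (Fo y) (Fo x)" "Fm q \<cdot>\<^bsub>L\<^esub> Fm i = Zero L (Fo x) (Fo y)"
    using comp[of x s x i p] comp[of y s y j q] comp[of y s x j p] comp[of x s y i q]
      obj hom eq ident zero by simp_all
  moreover have "(Fm i \<cdot>\<^bsub>L\<^esub> Fm p) \<oplus>\<^sub>m\<^bsub>L\<^esub> (Fm j \<cdot>\<^bsub>L\<^esub> Fm q) = Ident L (Fo s)"
    using comp[of s x s p i] comp[of s y s q j] add[of s s "i \<cdot> p" "j \<cdot> q"]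
      Comp_in[of s x s p i] Comp_in[of s y s q j] obj hom eq(5) ident by simp
  ultimately show ?thesis
    unfolding is_biproduct_def using obj hom in_Obj in_Hom by blast
qed

end

section \<open>Thick subcategories\<close>

lemma thick_subcategoryD:
  assumes "thick_subcategory K S"
  shows "S \<subseteq> Obj K"
    and "zero_object K z \<Longrightarrow> z \<in> S"
    and "\<lbrakk>isomorphic K x y; x \<in> S\<rbrakk> \<Longrightarrow> y \<in> S"
    and "x \<in> Obj K \<Longrightarrow> Shift K x \<in> S \<longleftrightarrow> x \<in> S"
    and "\<lbrakk>dist_triangle K x y z f g h; x \<in> S; y \<in> S\<rbrakk> \<Longrightarrow> z \<in> S"
    and "\<lbrakk>direct_summand K x s; s \<in> S\<rbrakk> \<Longrightarrow> x \<in> S"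
  using assms unfolding thick_subcategory_def triangulated_subcategory_def by blast+

context triangulated_category
begin

lemma thick_subcategory_Obj: "thick_subcategory K (Obj K)"
proof -
  have "Shift K x \<in> Obj K" if "x \<in> Obj K" for x
    using Shift_equivalence that unfolding is_equivalence_def is_functor_def by blast
  then show ?thesis
    unfolding thick_subcategory_def triangulated_subcategory_def zero_object_def isomorphic_def
      dist_triangle_def triangle_def direct_summand_def is_biproduct_def by blast
qed

text \<open>Each closure condition passes to intersections; the factor \<open>Obj K\<close>, itself
  thick, covers the empty family.\<close>

lemma thick_subcategory_Inter:
  assumes "\<And>S. S \<in> F \<Longrightarrow> thick_subcategory K S"
  shows "thick_subcategory K (Obj K \<inter> \<Inter>F)"
proof -
  note O = thick_subcategoryD[OF thick_subcategory_Obj]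
  note D = thick_subcategoryD[OF assms]
  show ?thesis
    unfolding thick_subcategory_def triangulated_subcategory_def
  proof (intro conjI allI ballI impI)
    fix z assume "zero_object K z"
    then show "z \<in> Obj K \<inter> \<Inter>F" using O(2) D(2) by blast
  next
    fix x y assume "isomorphic K x y" "x \<in> Obj K \<inter> \<Inter>F"
    then show "y \<in> Obj K \<inter> \<Inter>F" using O(3) D(3) by blast
  next
    fix x assume "x \<in> Obj K"
    then show "x \<in> Obj K \<inter> \<Inter>F \<longleftrightarrow> Shift K x \<in> Obj K \<inter> \<Inter>F" using O(4) D(4) by auto
  next
    fix x y z f g h
    assume "dist_triangle K x y z f g h" "x \<in> Obj K \<inter> \<Inter>F" "y \<in> Obj K \<inter> \<Inter>F"
    then show "z \<in> Obj K \<inter> \<Inter>F" using O(5) D(5) by blast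
  next
    fix x s assume "direct_summand K x s" "s \<in> Obj K \<inter> \<Inter>F"
    then show "x \<in> Obj K \<inter> \<Inter>F" using O(6) D(6) by blast
  qed blast
qed

text \<open>An exact functor preserves zero objects, isomorphisms, distinguished triangles and
  biproducts, and commutes with the shift up to isomorphism, so every closure condition of
  \<open>S\<close> pulls back.\<close>

lemma thick_subcategory_preimage:
  assumes L: "triangulated_category L" and F: "is_exact_functor K L Fo Fm"
    and S: "thick_subcategory L S"
  shows "thick_subcategory K {x \<in> Obj K. Fo x \<in> S}"
proof -
  interpret L: triangulated_category L by (fact L)
  note pre = L.preadditive_category_axioms
  obtain \<xi> where add: "is_additive_functor K L Fo Fm"
    and nat: "natural_iso K L (Fo \<circ> Shift K) (Fm \<circ> Shift_mor K) (Shift L \<circ> Fo) (Shift_mor L \<circ> Fm) \<xi>"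
    and tri: "\<And>x y z f g h. dist_triangle K x y z f g h \<Longrightarrow>
      dist_triangle L (Fo x) (Fo y) (Fo z) (Fm f) (Fm g) (\<xi> x \<cdot>\<^bsub>L\<^esub> Fm h)"
    using F unfolding is_exact_functor_def by blast
  have fct: "is_functor K L Fo Fm"
    using add unfolding is_additive_functor_def by blast
  have obj: "Fo x \<in> Obj L" if "x \<in> Obj K" for x
    using fct that unfolding is_functor_def by blast
  have shift: "Shift K x \<in> Obj K" if "x \<in> Obj K" for x
    using thick_subcategoryD(4)[OF thick_subcategory_Obj that] that by blast
  have Lshift: "Shift L x \<in> Obj L" if "x \<in> Obj L" for x
    using thick_subcategoryD(4)[OF L.thick_subcategory_Obj that] that by blast
  note D = thick_subcategoryD[OF S]
  note O = thick_subcategoryD[OF thick_subcategory_Obj]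
  show ?thesis
    unfolding thick_subcategory_def triangulated_subcategory_def
  proof (intro conjI allI ballI impI)
    fix z assume "zero_object K z"
    then show "z \<in> {x \<in> Obj K. Fo x \<in> S}"
      using D(2) O(2) additive_functor_zero_object[OF pre add] by blast
  next
    fix x y assume "isomorphic K x y" "x \<in> {x \<in> Obj K. Fo x \<in> S}"
    then show "y \<in> {x \<in> Obj K. Fo x \<in> S}"
      using D(3) O(3) isomorphic_functor[OF fct] by blast
  next
    fix x assume x: "x \<in> Obj K"
    \<comment> \<open>The component of \<xi> at \<open>x\<close> is the isomorphism.\<close>
    have "isomorphic L (Fo (Shift K x)) (Shift L (Fo x))"
      using nat x obj shift Lshift unfolding natural_iso_def isomorphic_def by auto
    then have "Fo (Shift K x) \<in> S \<longleftrightarrow> Shift L (Fo x) \<in> S"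
      using D(3) L.isomorphic_sym by blast
    then show "x \<in> {x \<in> Obj K. Fo x \<in> S} \<longleftrightarrow> Shift K x \<in> {x \<in> Obj K. Fo x \<in> S}"
      using D(4) obj shift x by simp
  next
    fix x y z f g h
    assume "dist_triangle K x y z f g h" "x \<in> {x \<in> Obj K. Fo x \<in> S}" "y \<in> {x \<in> Obj K. Fo x \<in> S}"
    then show "z \<in> {x \<in> Obj K. Fo x \<in> S}"
      using D(5) O(5) tri by blast
  next
    fix x s assume xs: "direct_summand K x s" "s \<in> {x \<in> Obj K. Fo x \<in> S}"
    then have "direct_summand L (Fo x) (Fo s)"
      unfolding direct_summand_def using additive_functor_biproduct[OF pre add] obj by blast
    then show "x \<in> {x \<in> Obj K. Fo x \<in> S}"
      using D(6) O(6) xs by blast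
  qed blast
qed

end

section \<open>Thick tensor ideals\<close>

lemma thick_idealsD:
  assumes "I \<in> thick_ideals K"
  shows "thick_subcategory K I"
    and "I \<subseteq> Obj K"
    and "\<lbrakk>x \<in> I; y \<in> Obj K\<rbrakk> \<Longrightarrow> x \<otimes>\<^sub>o\<^bsub>K\<^esub> y \<in> I"
    and "\<lbrakk>x \<in> I; y \<in> Obj K\<rbrakk> \<Longrightarrow> y \<otimes>\<^sub>o\<^bsub>K\<^esub> x \<in> I"
  using assms thick_subcategoryD(1) unfolding thick_ideals_def by blast+

section \<open>Prime and semiprime ideals\<close>

lemma prime_ideals_thick: "prime_ideals K \<subseteq> thick_ideals K"
  unfolding prime_ideals_def by blast

lemma tensor_set_subset_Int:
  assumes "I \<in> thick_ideals K" "J \<in> thick_ideals K"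
  shows "tensor_set K I J \<subseteq> I \<inter> J"
  using thick_idealsD[OF assms(1)] thick_idealsD[OF assms(2)]
  unfolding tensor_set_def by blast

lemma prime_wrt_mono: "\<lbrakk>prime_wrt K F P; G \<subseteq> F\<rbrakk> \<Longrightarrow> prime_wrt K G P"
  unfolding prime_wrt_def by blast

text \<open>For \<open>x\<close> in \<open>I\<close> and \<open>y\<close> in \<open>J\<close>, every
  x \<otimes> z already lies in \<open>I\<close>, so the sandwich of \<open>x\<close> and
  \<open>y\<close> lies in I \<otimes> J. If both inclusions failed, witnesses \<open>x\<close> and
  \<open>y\<close> outside \<open>P\<close> would contradict this.\<close>

lemma prime_on_objects_imp_prime_wrt:
  assumes "prime_on_objects K P"
  shows "prime_wrt K (thick_ideals K) P"
  unfolding prime_wrt_def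
proof (intro ballI impI)
  fix I J
  assume I: "I \<in> thick_ideals K" and J: "J \<in> thick_ideals K" and IJ: "tensor_set K I J \<subseteq> P"
  have "x \<in> P \<or> y \<in> P" if x: "x \<in> I" and y: "y \<in> J" for x y
  proof -
    have "sandwich K x y \<subseteq> tensor_set K I J"
      using thick_idealsD(3)[OF I x] y unfolding sandwich_def tensor_set_def by blast
    then show ?thesis
      using assms IJ thick_idealsD(2)[OF I] thick_idealsD(2)[OF J] x y
      unfolding prime_on_objects_def by blast
  qed
  then show "I \<subseteq> P \<or> J \<subseteq> P" by blast
qed

text \<open>A proper \<open>P\<close> is the intersection of the family {P}; the whole category is
  not counted among the primes, but it is the empty intersection.\<close>

lemma prime_wrt_imp_semiprime:
  assumes "P \<in> thick_ideals K" "prime_wrt K (thick_ideals K) P"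
  shows "P \<in> semiprime_ideals K"
proof (cases "P = Obj K")
  case True
  then have "P = Obj K \<inter> \<Inter>{}" by simp
  then show ?thesis unfolding semiprime_ideals_def by blast
next
  case False
  then have "{P} \<subseteq> prime_ideals K"
    using assms unfolding prime_ideals_def by blast
  moreover have "P = Obj K \<inter> \<Inter>{P}"
    using thick_idealsD(2)[OF assms(1)] by blast
  ultimately show ?thesis unfolding semiprime_ideals_def by blast
qed

section \<open>Meet-primeness among semiprime ideals\<close>

lemma meet_prime_semiprime_lattice_iff:
  "meet_prime (semiprime_lattice K) P \<longleftrightarrow> P \<in> semiprime_ideals K \<and>
    (\<forall>I \<in> semiprime_ideals K. \<forall>J \<in> semiprime_ideals K. I \<inter> J \<subseteq> P \<longrightarrow> I \<subseteq> P \<or> J \<subseteq> P)"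
proof -
  have "carrier (semiprime_lattice K) = semiprime_ideals K"
    "\<And>I J. I \<sqsubseteq>\<^bsub>semiprime_lattice K\<^esub> J \<longleftrightarrow> I \<subseteq> J"
    by (simp_all add: semiprime_lattice_def)
  then show ?thesis
    by (simp add: meet_prime_def meet_semiprime_lattice)
qed

lemma meet_prime_imp_prime_wrt:
  assumes "meet_prime (semiprime_lattice K) P"
  shows "prime_wrt K (thick_ideals K) P"
  unfolding prime_wrt_def
proof (intro ballI impI)
  fix I J
  assume I: "I \<in> thick_ideals K" and J: "J \<in> thick_ideals K" and IJ: "tensor_set K I J \<subseteq> P"
  obtain F where F: "F \<subseteq> prime_ideals K" and P: "P = Obj K \<inter> \<Inter>F"
    using assms unfolding meet_prime_semiprime_lattice_iff semiprime_ideals_def by blast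
  \<comment> \<open>These are semiprime ideals above \<open>I\<close> and \<open>J\<close>, which
    need not be semiprime themselves. Either family may be empty, and the corresponding ideal is
    then \<open>Obj K\<close>.\<close>
  let ?A = "Obj K \<inter> \<Inter>{Q \<in> F. I \<subseteq> Q}" and ?B = "Obj K \<inter> \<Inter>{Q \<in> F. J \<subseteq> Q}"
  \<comment> \<open>\<open>P\<close> lies in \<open>Q\<close>, so primeness of \<open>Q\<close>
    applies to I \<otimes> J.\<close>
  have "I \<subseteq> Q \<or> J \<subseteq> Q" if "Q \<in> F" for Q
    using F that P IJ I J unfolding prime_ideals_def prime_wrt_def by blast
  then have "?A \<inter> ?B \<subseteq> P"
    unfolding P by blast
  moreover have "?A \<in> semiprime_ideals K" "?B \<in> semiprime_ideals K"
    using F unfolding semiprime_ideals_def by blast+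
  ultimately have "?A \<subseteq> P \<or> ?B \<subseteq> P"
    using assms unfolding meet_prime_semiprime_lattice_iff by blast
  moreover have "I \<subseteq> ?A" "J \<subseteq> ?B"
    using thick_idealsD(2)[OF I] thick_idealsD(2)[OF J] by blast+
  ultimately show "I \<subseteq> P \<or> J \<subseteq> P" by blast
qed

section \<open>Quotient ideals and primeness on objects\<close>

context monoidal_triangulated_category
begin

lemma Tensor_in: "\<lbrakk>x \<in> Obj K; y \<in> Obj K\<rbrakk> \<Longrightarrow> x \<otimes>\<^sub>o y \<in> Obj K"
  using Tensor_functor unfolding is_functor_def prod_category_def by auto

lemma isomorphic_Associator:
  assumes "x \<in> Obj K" "y \<in> Obj K" "z \<in> Obj K"
  shows "isomorphic K ((x \<otimes>\<^sub>o y) \<otimes>\<^sub>o z) (x \<otimes>\<^sub>o (y \<otimes>\<^sub>o z))"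
proof -
  have "is_iso_mor K ((x \<otimes>\<^sub>o y) \<otimes>\<^sub>o z) (x \<otimes>\<^sub>o (y \<otimes>\<^sub>o z)) (Associator K x y z)"
    using Associator_natural assms unfolding natural_iso_def prod_category_def by simp
  then show ?thesis
    unfolding isomorphic_def using assms Tensor_in by blast
qed

lemma isomorphic_Right_unitor: "x \<in> Obj K \<Longrightarrow> isomorphic K (x \<otimes>\<^sub>o Unit K) x"
  using Right_unitor_natural Tensor_in Unit_in unfolding natural_iso_def isomorphic_def by blast

lemma isomorphic_Tensor_left:
  assumes "isomorphic K x x'" "y \<in> Obj K"
  shows "isomorphic K (x \<otimes>\<^sub>o y) (x' \<otimes>\<^sub>o y)"
  using isomorphic_functor[OF _ assms(1), of K "\<lambda>x. x \<otimes>\<^sub>o y"] Tensor_exact_left[OF assms(2)]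
  unfolding is_exact_functor_def is_additive_functor_def by blast

text \<open>An intersection of preimages of \<open>S\<close> under the exact functors x \<otimes>
  -.\<close>

lemma thick_subcategory_tensor_right:
  assumes "thick_subcategory K S" "X \<subseteq> Obj K"
  shows "thick_subcategory K {b \<in> Obj K. \<forall>x \<in> X. x \<otimes>\<^sub>o b \<in> S}"
proof -
  have "thick_subcategory K (Obj K \<inter> \<Inter>((\<lambda>x. {b \<in> Obj K. x \<otimes>\<^sub>o b \<in> S}) ` X))"
    using assms thick_subcategory_preimage[OF triangulated_category_axioms Tensor_exact_right]
    by (intro thick_subcategory_Inter) blast
  also have "Obj K \<inter> \<Inter>((\<lambda>x. {b \<in> Obj K. x \<otimes>\<^sub>o b \<in> S}) ` X) = {b \<in> Obj K. \<forall>x \<in> X. x \<otimes>\<^sub>o b \<in> S}"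
    by blast
  finally show ?thesis .
qed

lemma thick_subcategory_tensor_left:
  assumes "thick_subcategory K S" "X \<subseteq> Obj K"
  shows "thick_subcategory K {a \<in> Obj K. \<forall>x \<in> X. a \<otimes>\<^sub>o x \<in> S}"
proof -
  have "thick_subcategory K (Obj K \<inter> \<Inter>((\<lambda>x. {a \<in> Obj K. a \<otimes>\<^sub>o x \<in> S}) ` X))"
    using assms thick_subcategory_preimage[OF triangulated_category_axioms Tensor_exact_left]
    by (intro thick_subcategory_Inter) blast
  also have "Obj K \<inter> \<Inter>((\<lambda>x. {a \<in> Obj K. a \<otimes>\<^sub>o x \<in> S}) ` X) = {a \<in> Obj K. \<forall>x \<in> X. a \<otimes>\<^sub>o x \<in> S}"
    by blast
  finally show ?thesis .
qed

lemma semiprime_ideals_thick: "semiprime_ideals K \<subseteq> thick_ideals K"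
proof
  fix I assume "I \<in> semiprime_ideals K"
  then obtain F where "F \<subseteq> prime_ideals K" and I: "I = Obj K \<inter> \<Inter>F"
    unfolding semiprime_ideals_def by blast
  then have F: "\<And>Q. Q \<in> F \<Longrightarrow> Q \<in> thick_ideals K"
    using prime_ideals_thick by blast
  show "I \<in> thick_ideals K"
    unfolding thick_ideals_def I
    using thick_subcategory_Inter[of F] thick_idealsD[OF F] Tensor_in by auto
qed

text \<open>A factor \<open>w\<close> to the right of \<open>b\<close> is absorbed by the ideal
  \<open>P\<close>; a factor \<open>w\<close> to the left of \<open>b\<close> is absorbed into the
  middle object, which ranges over all of \<open>K\<close>. Associators move the brackets, and
  \<open>P\<close> is closed under isomorphism.\<close>

lemma right_quotient_thick_ideal:
  assumes P: "P \<in> thick_ideals K" and x: "x \<in> Obj K"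
  shows "{b \<in> Obj K. sandwich K x b \<subseteq> P} \<in> thick_ideals K" (is "?J \<in> _")
proof -
  note D = thick_idealsD[OF P]
  note iso = thick_subcategoryD(3)[OF D(1)]
  \<comment> \<open>Since \<otimes> associates to the left, the sandwich condition fixes left
    factors x \<otimes> z, the form required for thickness.\<close>
  have J: "?J = {b \<in> Obj K. \<forall>c \<in> (\<lambda>z. x \<otimes>\<^sub>o z) ` Obj K. c \<otimes>\<^sub>o b \<in> P}"
    unfolding sandwich_def by blast
  have "(x \<otimes>\<^sub>o z) \<otimes>\<^sub>o (b \<otimes>\<^sub>o w) \<in> P" if "b \<in> ?J" "w \<in> Obj K" "z \<in> Obj K" for b w z
  proof -
    have "((x \<otimes>\<^sub>o z) \<otimes>\<^sub>o b) \<otimes>\<^sub>o w \<in> P"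
      using that D(3) J by auto
    then show ?thesis
      using iso[OF isomorphic_Associator[of "x \<otimes>\<^sub>o z" b w]] that x Tensor_in by blast
  qed
  moreover have "(x \<otimes>\<^sub>o z) \<otimes>\<^sub>o (w \<otimes>\<^sub>o b) \<in> P" if b: "b \<in> ?J" and w: "w \<in> Obj K" and z: "z \<in> Obj K"
    for b w z
  proof -
    \<comment> \<open>The hypothesis on \<open>b\<close> with middle object z \<otimes> w.\<close>
    have "(x \<otimes>\<^sub>o (z \<otimes>\<^sub>o w)) \<otimes>\<^sub>o b \<in> P"
      using that Tensor_in J by auto
    moreover have "isomorphic K ((x \<otimes>\<^sub>o (z \<otimes>\<^sub>o w)) \<otimes>\<^sub>o b) (((x \<otimes>\<^sub>o z) \<otimes>\<^sub>o w) \<otimes>\<^sub>o b)"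
      using isomorphic_Tensor_left[OF isomorphic_sym[OF isomorphic_Associator[OF x z w]]] b by blast
    ultimately have "((x \<otimes>\<^sub>o z) \<otimes>\<^sub>o w) \<otimes>\<^sub>o b \<in> P"
      using iso by blast
    then show ?thesis
      using iso[OF isomorphic_Associator[of "x \<otimes>\<^sub>o z" w b]] that x Tensor_in by blast
  qed
  moreover have "thick_subcategory K ?J"
    unfolding J using x Tensor_in by (intro thick_subcategory_tensor_right D(1)) blast
  ultimately show ?thesis
    unfolding thick_ideals_def using J Tensor_in by auto
qed

text \<open>For (a \<otimes> w) \<otimes> b the object w \<otimes> b is again in the ideal
  \<open>J\<close>; for (w \<otimes> a) \<otimes> b the ideal \<open>P\<close> absorbs
  \<open>w\<close>.\<close>

lemma left_quotient_thick_ideal: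
  assumes P: "P \<in> thick_ideals K" and J: "J \<in> thick_ideals K"
  shows "{a \<in> Obj K. \<forall>b \<in> J. a \<otimes>\<^sub>o b \<in> P} \<in> thick_ideals K" (is "?I \<in> _")
proof -
  note D = thick_idealsD[OF P]
  note E = thick_idealsD[OF J]
  note iso = thick_subcategoryD(3)[OF D(1)]
  have "(a \<otimes>\<^sub>o w) \<otimes>\<^sub>o b \<in> P" if "a \<in> ?I" "w \<in> Obj K" "b \<in> J" for a w b
    using iso[OF isomorphic_sym[OF isomorphic_Associator[of a w b]]] that E(2) E(4)[of b w] by blast
  moreover have "(w \<otimes>\<^sub>o a) \<otimes>\<^sub>o b \<in> P" if "a \<in> ?I" "w \<in> Obj K" "b \<in> J" for a w b
    using iso[OF isomorphic_sym[OF isomorphic_Associator[of w a b]]] that E(2) D(4) by blast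
  moreover have "thick_subcategory K ?I"
    using D(1) E(2) by (rule thick_subcategory_tensor_left)
  ultimately show ?thesis
    unfolding thick_ideals_def using Tensor_in by auto
qed

text \<open>The two quotient ideals play the role of the thick ideals generated by \<open>x\<close>
  and \<open>y\<close>: they contain these objects, and their product lies in \<open>P\<close> by
  construction.\<close>

lemma prime_wrt_imp_prime_on_objects:
  assumes P: "P \<in> thick_ideals K" and prime: "prime_wrt K (thick_ideals K) P"
  shows "prime_on_objects K P"
  unfolding prime_on_objects_def
proof (intro ballI impI)
  fix x y assume x: "x \<in> Obj K" and y: "y \<in> Obj K" and xy: "sandwich K x y \<subseteq> P"
  let ?J = "{b \<in> Obj K. sandwich K x b \<subseteq> P}"
  let ?I = "{a \<in> Obj K. \<forall>b \<in> ?J. a \<otimes>\<^sub>o b \<in> P}"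
  have J: "?J \<in> thick_ideals K"
    using P x by (rule right_quotient_thick_ideal)
  have I: "?I \<in> thick_ideals K"
    using P J by (rule left_quotient_thick_ideal)
  have "tensor_set K ?I ?J \<subseteq> P"
    unfolding tensor_set_def by blast
  then have "?I \<subseteq> P \<or> ?J \<subseteq> P"
    using prime[unfolded prime_wrt_def, rule_format, OF I J] by blast
  moreover have "x \<in> ?I"
  proof -
    have "x \<otimes>\<^sub>o b \<in> P" if b: "b \<in> ?J" for b
    proof -
      \<comment> \<open>The sandwich condition with the unit in the middle.\<close>
      have "x \<otimes>\<^sub>o Unit K \<otimes>\<^sub>o b \<in> P"
        using b Unit_in unfolding sandwich_def by blast
      moreover have "isomorphic K (x \<otimes>\<^sub>o Unit K \<otimes>\<^sub>o b) (x \<otimes>\<^sub>o b)"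
        using b x isomorphic_Tensor_left isomorphic_Right_unitor by blast
      ultimately show ?thesis
        using thick_subcategoryD(3)[OF thick_idealsD(1)[OF P]] by blast
    qed
    with x show ?thesis by blast
  qed
  moreover have "y \<in> ?J"
    using y xy by blast
  ultimately show "x \<in> P \<or> y \<in> P" by blast
qed

text \<open>The meet is the intersection, which contains I \<otimes> J; so a meet below
  \<open>P\<close> forces the product into \<open>P\<close>.\<close>

lemma prime_wrt_semiprimes_imp_meet_prime:
  assumes "prime_wrt_semiprimes K P"
  shows "meet_prime (semiprime_lattice K) P"
proof -
  have "tensor_set K I J \<subseteq> I \<inter> J" if "I \<in> semiprime_ideals K" "J \<in> semiprime_ideals K" for I J
    using tensor_set_subset_Int that semiprime_ideals_thick by blast
  then show ?thesis
    using assms unfolding meet_prime_semiprime_lattice_iff prime_wrt_semiprimes_def prime_wrt_def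
    by (meson subset_trans)
qed

end

theorem proposition4p7:
  fixes K :: "('o, 'm) mt_category" and P :: "'o set"
  assumes "monoidal_triangulated_category K"
    and "P \<in> thick_ideals K"
  shows "(prime_wrt K (thick_ideals K) P \<longleftrightarrow> prime_on_objects K P) \<and>
    (prime_on_objects K P \<longleftrightarrow> prime_wrt_semiprimes K P) \<and>
    (prime_wrt_semiprimes K P \<longleftrightarrow> meet_prime (semiprime_lattice K) P) \<and>
    (P \<noteq> Obj K \<longrightarrow> (P \<in> prime_ideals K \<longleftrightarrow> prime_on_objects K P))"
proof -
  interpret monoidal_triangulated_category K by (fact assms(1))
  have ab: "prime_wrt K (thick_ideals K) P \<longleftrightarrow> prime_on_objects K P"
    using prime_wrt_imp_prime_on_objects[OF assms(2)] prime_on_objects_imp_prime_wrt by blast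
  \<comment> \<open>Being prime among all thick ideals makes \<open>P\<close> semiprime and
    restricts to the smaller family of semiprimes.\<close>
  have ac: "prime_wrt K (thick_ideals K) P \<Longrightarrow> prime_wrt_semiprimes K P"
    using prime_wrt_imp_semiprime[OF assms(2)] prime_wrt_mono semiprime_ideals_thick
    unfolding prime_wrt_semiprimes_def by blast
  \<comment> \<open>Membership in \<open>prime_ideals\<close> adds properness to (a), a condition
    that the whole category also satisfies.\<close>
  have "P \<noteq> Obj K \<longrightarrow> (P \<in> prime_ideals K \<longleftrightarrow> prime_wrt K (thick_ideals K) P)"
    using assms(2) unfolding prime_ideals_def by blast
  \<comment> \<open>The cycle (a) to (c) to (d) to (a) closes, with (b) attached to (a).\<close>
  then show ?thesis
    using ab ac prime_wrt_semiprimes_imp_meet_prime meet_prime_imp_prime_wrt by blast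
qed

end
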